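(* Let $N\ge1$ and $b\ge1$ be integers and let $c>0$. The double generating function of $(\sigma_b^+,S_b^+)$ is given, for any $z\in(0,1/M_1)$ and any $\zeta\in\mathbb{C}$, by $$\mathbb{E}\!\left(z^{\sigma_b^+}\zeta^{S_b^+}1_{\{\sigma_b^+<+\infty\}}\right)=\sum_{k=1}^N\mathbf{L}_k(z,\zeta)\,(u_k(z)\zeta)^b,$$ where $$\mathbf{L}_k(z,\zeta)=\prod_{\substack{1\le j\le N\\ j\ne k}}\frac{\zeta-v_j(z)}{v_k(z)-v_j(z)},\qquad k\in\{1,\dots,N\},$$ are the Lagrange interpolation polynomials in the variable $\zeta$ such that $\mathbf{L}_k(z,v_j(z))=\delta_{jk}$.
   Context: Pseudo-random walk: put $p_k=\delta_{k0}+(-1)^{k-1}c\binom{2N}{k+N}$ for $k\in\{-N,\dots,N\}$ (real numbers, possibly negative, summing to $1$) and $p_k=0$ for other integers $k$. The $U_n$, $n\ge1$, are i.i.d. pseudo-random variables with $\mathbb{P}\{U_n=k\}=p_k$, i.e. $\mathbb{P}\{U_1=k_1,\dots,U_n=k_n\}=p_{k_1}\cdots p_{k_n}$ (a signed measure of total mass one); $S_0=0$, $S_n=U_1+\dots+U_n$. First overshooting time: $\sigma_b^+=\min\{n\ge1:S_n\ge b\}$ ($\min\emptyset=+\infty$), $S_b^+=S_{\sigma_b^+}\in\{b,\dots,b+N-1\}$; $\mathbb{P}\{\sigma_b^+=k,S_b^+=\ell\}=\mathbb{P}\{S_1<b,\dots,S_{k-1}<b,S_k=\ell\}$ for $k\ge1$.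 $M_1=\sum_{k=-N}^N|p_k|\ge1$. For $|z|<1/M_1$, $$\mathbb{E}\big(z^{\sigma_b^+}\zeta^{S_b^+}1_{\{\sigma_b^+<+\infty\}}\big)=\sum_{\ell=b}^{b+N-1}\Big(\sum_{k\ge1}\mathbb{P}\{\sigma_b^+=k,S_b^+=\ell\}z^k\Big)\zeta^\ell,$$ the inner series being absolutely convergent. Roots: for $z\in(0,1)$ and $1\le j\le N$, let $\theta_j=-\mathrm{e}^{\mathrm{i}\frac{2j-1}{N}\pi}$ and $w(z)=\frac12\sqrt[N]{(1-z)/(cz)}$. The quadratic equation $u^2-2[1+\theta_jw(z)]u+1=0$ has exactly one root of modulus $<1$, denoted $u_j(z)$; the other root is $v_j(z)=1/u_j(z)$. The numbers $u_1(z),\dots,u_N(z)$ are pairwise distinct. *)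

theory Defs
  imports "HOL-Analysis.Analysis" "HOL-Library.Extended_Nat" "HOL-Library.FuncSet"
begin

definition step_p :: "nat \<Rightarrow> real \<Rightarrow> int \<Rightarrow> real" where
  "step_p N c k =
     (if k \<in> {- int N..int N}
      then (if k = 0 then 1 else 0) + (-1) powi (k - 1) * c * real ((2 * N) choose nat (k + int N))
      else 0)"

definition M1 :: "nat \<Rightarrow> real \<Rightarrow> real" where
  "M1 N c = (\<Sum>k\<in>{- int N..int N}. \<bar>step_p N c k\<bar>)"

text \<open>
  The signed law of \<open>(U 1, \<dots>, U n)\<close>, evaluated at an event \<open>A\<close> on step sequences.
  The coordinates are \<open>u 1, \<dots>, u n\<close> (the value \<open>u 0\<close> is never used), and only steps in
  \<open>{- N..N}\<close> are summed over because \<open>step_p\<close> vanishes elsewhere.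
  The value is meaningful for events that depend on \<open>u 1, \<dots>, u n\<close> only.
\<close>

definition pseudo_prob :: "nat \<Rightarrow> real \<Rightarrow> nat \<Rightarrow> (nat \<Rightarrow> int) set \<Rightarrow> real" where
  "pseudo_prob N c n A =
     (\<Sum>u | u \<in> ({1..n} \<rightarrow>\<^sub>E {- int N..int N}) \<and> u \<in> A. \<Prod>i\<in>{1..n}. step_p N c (u i))"

definition walk :: "(nat \<Rightarrow> int) \<Rightarrow> nat \<Rightarrow> int" where
  "walk u n = (\<Sum>i\<in>{1..n}. u i)"

text \<open>The infimum of the empty set in \<^typ>\<open>enat\<close> is \<open>\<infinity>\<close>.\<close>

definition overshoot_time :: "nat \<Rightarrow> (nat \<Rightarrow> int) \<Rightarrow> enat" where
  "overshoot_time b u = Inf (enat ` {n. n \<ge> 1 \<and> walk u n \<ge> int b})"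

text \<open>Only relevant when \<open>overshoot_time b u\<close> is finite.\<close>

definition overshoot_pos :: "nat \<Rightarrow> (nat \<Rightarrow> int) \<Rightarrow> int" where
  "overshoot_pos b u = walk u (the_enat (overshoot_time b u))"

text \<open>
  Joint pseudo-distribution of the overshooting time and location. The event depends on the
  first \<open>k\<close> steps only, so it is evaluated under the law of these steps.
\<close>

definition overshoot_prob :: "nat \<Rightarrow> real \<Rightarrow> nat \<Rightarrow> nat \<Rightarrow> nat \<Rightarrow> real" where
  "overshoot_prob N c b k l =
     pseudo_prob N c k {u. overshoot_time b u = enat k \<and> overshoot_pos b u = int l}"

definition overshoot_gf :: "nat \<Rightarrow> real \<Rightarrow> nat \<Rightarrow> complex \<Rightarrow> complex \<Rightarrow> complex" where
  "overshoot_gf N c b z \<zeta> =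
     (\<Sum>l = b..b + N - 1.
        (\<Sum>k. complex_of_real (overshoot_prob N c b (Suc k) l) * z ^ Suc k) * \<zeta> ^ l)"

definition root_theta :: "nat \<Rightarrow> nat \<Rightarrow> complex" where
  "root_theta N j = - exp (\<i> * complex_of_real ((2 * real j - 1) / real N * pi))"

definition root_w :: "nat \<Rightarrow> real \<Rightarrow> real \<Rightarrow> real" where
  "root_w N c z = 1 / 2 * root N ((1 - z) / (c * z))"

definition root_u :: "nat \<Rightarrow> real \<Rightarrow> nat \<Rightarrow> real \<Rightarrow> complex" where
  "root_u N c j z =
     (THE u. u\<^sup>2 - 2 * (1 + root_theta N j * complex_of_real (root_w N c z)) * u + 1 = 0
             \<and> cmod u < 1)"

definition root_v :: "nat \<Rightarrow> real \<Rightarrow> nat \<Rightarrow> real \<Rightarrow> complex" where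
  "root_v N c j z = 1 / root_u N c j z"

definition lagrange_L :: "nat \<Rightarrow> real \<Rightarrow> nat \<Rightarrow> real \<Rightarrow> complex \<Rightarrow> complex" where
  "lagrange_L N c k z \<zeta> =
     (\<Prod>j\<in>{1..N} - {k}. (\<zeta> - root_v N c j z) / (root_v N c k z - root_v N c j z))"


subsection \<open>Well-definedness\<close>

lemma overshoot_event_eq:
  assumes "k \<ge> 1" "l \<ge> b"
  shows "{u. overshoot_time b u = enat k \<and> overshoot_pos b u = int l} =
         {u. (\<forall>i\<in>{1..<k}. walk u i < int b) \<and> walk u k = int l}"
proof -
  have "overshoot_time b u = enat k \<and> overshoot_pos b u = int l \<longleftrightarrow>
        (\<forall>i\<in>{1..<k}. walk u i < int b) \<and> walk u k = int l" for u
  proof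
    let ?X = "enat ` {n. n \<ge> 1 \<and> walk u n \<ge> int b}"
    assume *: "overshoot_time b u = enat k \<and> overshoot_pos b u = int l"
    have "walk u i < int b" if "i \<in> {1..<k}" for i
    proof (rule ccontr)
      assume "\<not> walk u i < int b"
      hence "enat i \<in> ?X" using that by auto
      hence "Inf ?X \<le> enat i" by (rule Inf_lower)
      thus False using * that by (auto simp: overshoot_time_def)
    qed
    thus "(\<forall>i\<in>{1..<k}. walk u i < int b) \<and> walk u k = int l"
      using * by (auto simp: overshoot_pos_def)
  next
    let ?X = "enat ` {n. n \<ge> 1 \<and> walk u n \<ge> int b}"
    assume *: "(\<forall>i\<in>{1..<k}. walk u i < int b) \<and> walk u k = int l"
    have "Inf ?X = enat k"
    proof (rule antisym)
      show "Inf ?X \<le> enat k" using * assms by (intro Inf_lower) auto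
      have "k \<le> n" if "n \<ge> 1" "walk u n \<ge> int b" for n
        using * that by (metis atLeastLessThan_iff not_le)
      thus "enat k \<le> Inf ?X" by (intro Inf_greatest) auto
    qed
    thus "overshoot_time b u = enat k \<and> overshoot_pos b u = int l"
      using * by (auto simp: overshoot_time_def overshoot_pos_def)
  qed
  thus ?thesis by blast
qed

lemma abs_pseudo_prob_le: "\<bar>pseudo_prob N c n A\<bar> \<le> M1 N c ^ n"
proof -
  let ?P = "{1..n} \<rightarrow>\<^sub>E {- int N..int N}"
  have fin: "finite ?P" by (intro finite_PiE) auto
  have "\<bar>pseudo_prob N c n A\<bar> \<le> (\<Sum>u | u \<in> ?P \<and> u \<in> A. \<bar>\<Prod>i\<in>{1..n}. step_p N c (u i)\<bar>)"
    unfolding pseudo_prob_def by (rule sum_abs)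
  also have "\<dots> \<le> (\<Sum>u\<in>?P. \<bar>\<Prod>i\<in>{1..n}. step_p N c (u i)\<bar>)"
    using fin by (intro sum_mono2) auto
  also have "\<dots> = (\<Sum>u\<in>?P. \<Prod>i\<in>{1..n}. \<bar>step_p N c (u i)\<bar>)"
    by (simp add: abs_prod)
  also have "\<dots> = (\<Prod>i\<in>{1..n}. \<Sum>k\<in>{- int N..int N}. \<bar>step_p N c k\<bar>)"
    by (rule prod_sum_PiE [symmetric]) auto
  finally show ?thesis by (simp add: M1_def)
qed

lemma summable_overshoot_gf:
  assumes "cmod z < 1 / M1 N c"
  shows "summable (\<lambda>k. norm (complex_of_real (overshoot_prob N c b (Suc k) l) * z ^ Suc k))"
proof -
  have "M1 N c \<ge> 0" by (simp add: M1_def sum_nonneg)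
  moreover have "M1 N c \<noteq> 0" using assms by auto
  ultimately have pos: "M1 N c > 0" by simp
  hence lt: "M1 N c * cmod z < 1" using assms by (simp add: field_simps)
  have "summable (\<lambda>k. (M1 N c * cmod z) ^ k)"
    using lt pos by (intro summable_geometric) (simp add: abs_mult)
  hence "summable (\<lambda>k. (M1 N c * cmod z) ^ Suc k)" by (subst summable_Suc_iff)
  moreover have "norm (norm (complex_of_real (overshoot_prob N c b (Suc k) l) * z ^ Suc k))
      \<le> (M1 N c * cmod z) ^ Suc k" for k
  proof -
    have "\<bar>overshoot_prob N c b (Suc k) l\<bar> * cmod z ^ Suc k \<le> M1 N c ^ Suc k * cmod z ^ Suc k"
      unfolding overshoot_prob_def by (intro mult_right_mono abs_pseudo_prob_le) auto
    also have "\<dots> = (M1 N c * cmod z) ^ Suc k" by (rule power_mult_distrib [symmetric])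
    finally show ?thesis by (simp only: norm_mult norm_power norm_of_real abs_norm_cancel real_norm_def
          abs_mult abs_abs power_abs abs_norm_cancel)
  qed
  ultimately show ?thesis by (rule summable_comparison_test'[where N = 0])
qed

lemma root_theta_neq_minus_1:
  assumes "N \<ge> 1"
  shows "root_theta N j \<noteq> -1"
proof
  assume "root_theta N j = -1"
  hence "exp (\<i> * complex_of_real ((2 * real j - 1) / real N * pi)) = 1"
    by (simp add: root_theta_def)
  then obtain m :: int where "(2 * real j - 1) / real N * pi = real_of_int (2 * m) * pi"
    by (auto simp: exp_eq_1)
  hence "(2 * real j - 1) / real N = real_of_int (2 * m)"
    by (simp only: mult_cancel_right pi_neq_zero simp_thms)
  hence "2 * real j - 1 = real_of_int (2 * m) * real N"
    using assms by (simp add: field_simps)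
  hence "real_of_int (2 * int j - 1) = real_of_int (2 * m * int N)" by simp
  hence "2 * int j - 1 = 2 * (m * int N)" by (simp only: of_int_eq_iff mult.assoc)
  thus False by presburger
qed

lemma root_u_ex1:
  assumes "N \<ge> 1" "c > 0" "0 < z" "z < 1"
  shows "\<exists>!u. u\<^sup>2 - 2 * (1 + root_theta N j * complex_of_real (root_w N c z)) * u + 1 = 0
             \<and> cmod u < 1"
proof -
  define w where "w = root_w N c z"
  define t where "t = root_theta N j"
  define a where "a = 1 + t * complex_of_real w"
  have w: "w > 0" using assms by (simp add: w_def root_w_def real_root_gt_zero)
  have t: "cmod t = 1" unfolding t_def root_theta_def norm_minus_cancel by (rule norm_exp_i_times)
  define r where "r = a + csqrt (a\<^sup>2 - 1)"
  define s where "s = a - csqrt (a\<^sup>2 - 1)"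
  have rs: "r * s = 1" "r + s = 2 * a"
    by (simp_all add: r_def s_def algebra_simps flip: power2_eq_square)
  have fac: "u\<^sup>2 - 2 * a * u + 1 = (u - r) * (u - s)" for u
  proof -
    have "(u - r) * (u - s) = u\<^sup>2 - (r + s) * u + r * s"
      by (simp add: algebra_simps power2_eq_square)
    thus ?thesis by (simp add: rs)
  qed
  have n: "cmod r * cmod s = 1" using rs by (metis norm_mult norm_one)
  have "cmod r \<noteq> 1"
  proof
    assume r1: "cmod r = 1"
    hence "r * cnj r = 1" by (simp add: complex_norm_square [symmetric])
    hence "s = cnj r" using rs(1) r1 by (metis mult_cancel_left norm_zero zero_neq_one)
    hence "a = complex_of_real (Re r)" using rs(2) by (simp add: complex_eq_iff)
    hence tw: "t * complex_of_real w = complex_of_real (Re r - 1)" by (simp add: a_def algebra_simps)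
    hence "Im t * w = 0" "Re t * w = Re r - 1" by (simp_all add: complex_eq_iff)
    hence im: "Im t = 0" and re: "Re t * w \<le> 0"
      using w complex_Re_le_cmod[of r] r1 by auto
    have "\<bar>Re t\<bar> = 1" using t im by (simp add: cmod_def)
    moreover have "Re t \<le> 0" using re w by (simp add: mult_le_0_iff)
    ultimately have "t = -1" using im by (simp add: complex_eq_iff)
    thus False using root_theta_neq_minus_1[OF assms(1)] by (simp add: t_def)
  qed
  moreover have "cmod s = 1 / cmod r" using n by (metis mult_cancel_left1 mult_zero_left
      nonzero_mult_div_cancel_left zero_neq_one)
  moreover have "cmod r > 0" using n by auto
  ultimately consider "cmod r < 1" "cmod s > 1" | "cmod r > 1" "cmod s < 1"
    by (cases "cmod r < 1") (auto simp: field_simps)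
  hence "\<exists>!u. u\<^sup>2 - 2 * a * u + 1 = 0 \<and> cmod u < 1"
    unfolding fac by cases (auto intro: ex1I[of _ r] ex1I[of _ s])
  thus ?thesis by (simp only: a_def t_def w_def)
qed

end

theory Submission
  imports Defs "HOL-Computational_Algebra.Polynomial"
begin

text \<open>
  The proof is optional stopping for the pseudo-random walk, followed by interpolation.

  If \<open>z * \<Sum>\<^sub>k p\<^sub>k v\<^sup>k = 1\<close>, then \<open>z\<^sup>n v^(S\<^sub>n)\<close> has constant pseudo-expectation \<open>1\<close>. Stop the walk
  at the first overshooting time. The paths stopped up to time \<open>n\<close> contribute a partial sum of the
  generating function at \<open>\<zeta> = v\<close>, and the paths that are still below \<open>b\<close> contribute at most
  \<open>(z M\<^sub>1)\<^sup>n \<bar>v\<bar>\<^sup>b\<close> as soon as \<open>\<bar>v\<bar> \<ge> 1\<close>, which tends to \<open>0\<close>. So the generating function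
  equals \<open>1\<close> at every such \<open>v\<close> (\<open>overshoot_gf_eq_1\<close>).

  The binomial theorem gives \<open>\<Sum>\<^sub>k p\<^sub>k v\<^sup>k = 1 - c (-(1 - v)\<^sup>2 / v)\<^sup>N\<close>. The quadratic equation that
  defines \<open>u\<^sub>j\<close> says \<open>(1 - v)\<^sup>2 / v = 2 \<theta>\<^sub>j w\<close> for \<open>v = u\<^sub>j\<close>, and equally for the other root \<open>v\<^sub>j\<close>;
  as \<open>(-\<theta>\<^sub>j)\<^sup>N = -1\<close> and \<open>(2 w)\<^sup>N = (1 - z) / (c z)\<close>, the \<open>N\<close> points \<open>v\<^sub>j\<close>, which lie outside
  the unit disc, satisfy the hypothesis on \<open>v\<close> (\<open>step_gf_root_v\<close>). They are distinct because \<open>v\<^sub>j\<close>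
  determines \<open>\<theta>\<^sub>j\<close> and the \<open>\<theta>\<^sub>j\<close> are distinct.

  A jump has size at most \<open>N\<close>, so the overshooting place takes only \<open>N\<close> values and the
  generating function is \<open>\<zeta>\<^sup>b\<close> times a polynomial of degree less than \<open>N\<close>. This polynomial takes
  the value \<open>v\<^sub>j\<^sup>-\<^sup>b = u\<^sub>j\<^sup>b\<close> at \<open>v\<^sub>j\<close>, and Lagrange interpolation at \<open>v\<^sub>1, \<dots>, v\<^sub>N\<close> recovers it.
\<close>

section \<open>Lagrange interpolation\<close>

lemma lagrange_basis_at_node:
  fixes x :: "'i \<Rightarrow> 'a::field"
  assumes "finite I" "inj_on x I" "i \<in> I" "k \<in> I"
  shows "(\<Prod>j\<in>I - {k}. (x i - x j) / (x k - x j)) = (if i = k then 1 else 0)"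
proof (cases "i = k")
  case True
  have "(x k - x j) / (x k - x j) = 1" if "j \<in> I - {k}" for j
    using that assms by (auto simp: inj_on_def)
  then show ?thesis using True by simp
next
  case False
  then show ?thesis using assms by (auto intro!: prod_zero)
qed

text \<open>
  Both sides are polynomials in \<open>t\<close> of degree less than \<open>card I\<close>, and they agree at the
  \<open>card I\<close> nodes.
\<close>
lemma lagrange_interpolation:
  fixes x :: "'i \<Rightarrow> 'a::field" and p :: "'a poly"
  assumes "finite I" "inj_on x I" "degree p < card I"
  shows "poly p t = (\<Sum>k\<in>I. poly p (x k) * (\<Prod>j\<in>I - {k}. (t - x j) / (x k - x j)))"
proof -
  define L where "L k = (\<Prod>j\<in>I - {k}. [:- x j / (x k - x j), 1 / (x k - x j):])" for k
  define q where "q = (\<Sum>k\<in>I. smult (poly p (x k)) (L k))"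
  have poly_L: "poly (L k) s = (\<Prod>j\<in>I - {k}. (s - x j) / (x k - x j))" for k s
    unfolding L_def poly_prod by (intro prod.cong refl) (simp add: field_simps diff_divide_distrib)
  have poly_q: "poly q s = (\<Sum>k\<in>I. poly p (x k) * (\<Prod>j\<in>I - {k}. (s - x j) / (x k - x j)))" for s
    by (simp add: q_def poly_sum poly_L)
  have deg_L: "degree (L k) \<le> card I - 1" if "k \<in> I" for k
  proof -
    have "degree (L k) \<le> (\<Sum>j\<in>I - {k}. degree [:- x j / (x k - x j), 1 / (x k - x j):])"
      unfolding L_def using degree_prod_sum_le[of "I - {k}" "\<lambda>j. [:- x j / (x k - x j), 1 / (x k - x j):]"] assms(1)
      by (simp only: o_def finite_Diff)
    also have "\<dots> \<le> (\<Sum>j\<in>I - {k}. 1)" by (intro sum_mono) simp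
    finally show ?thesis using that by simp
  qed
  have "degree q \<le> card I - 1"
    unfolding q_def using deg_L assms(1)
    by (intro degree_sum_le) (auto intro: order.trans[OF degree_smult_le])
  then have "degree q < card I" using assms(3) by linarith
  moreover have "card (x ` I) = card I" using assms(2) by (rule card_image)
  moreover have "poly p s = poly q s" if s: "s \<in> x ` I" for s
  proof -
    obtain i where i: "i \<in> I" "s = x i" using s by blast
    have "poly q s = (\<Sum>k\<in>I. poly p (x k) * (if i = k then 1 else 0))"
      unfolding poly_q i(2) using lagrange_basis_at_node[OF assms(1,2) i(1)]
      by (intro sum.cong) auto
    also have "\<dots> = poly p s" using assms(1) i by (simp add: mult_delta_right)
    finally show ?thesis by simp
  qed
  ultimately have "p = q" using assms(3) by (intro poly_eqI_degree[of "x ` I"]) auto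
  then have "poly p t = poly q t" by (rule arg_cong)
  then show ?thesis by (rule trans[OF _ poly_q])
qed

section \<open>The generating function of a step\<close>

definition step_gf :: "nat \<Rightarrow> real \<Rightarrow> complex \<Rightarrow> complex" where
  "step_gf N c v = (\<Sum>k\<in>{- int N..int N}. of_real (step_p N c k) * v powi k)"

text \<open>
  After a shift of the index by \<open>N\<close> the alternating part of the sum is the binomial expansion of
  \<open>(1 - v)\<^sup>2\<^sup>N / v\<^sup>N\<close>.
\<close>
lemma step_gf_closed_form:
  assumes "v \<noteq> 0"
  shows "step_gf N c v = 1 - of_real c * (- ((1 - v)\<^sup>2 / v)) ^ N"
proof -
  let ?a = "\<lambda>k. of_real ((-1) powi (k - 1) * c * real ((2 * N) choose nat (k + int N))) * v powi k"
  have "step_gf N c v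
      = (\<Sum>k\<in>{- int N..int N}. (if k = 0 then 1 else 0) + ?a k)"
    unfolding step_gf_def by (intro sum.cong refl) (auto simp: step_p_def algebra_simps)
  also have "\<dots> = 1 + (\<Sum>k\<in>{- int N..int N}. ?a k)"
    by (simp add: sum.distrib)
  also have "(\<Sum>k\<in>{- int N..int N}. ?a k) = (\<Sum>m\<le>2 * N. ?a (int m - int N))"
    by (rule sum.reindex_bij_witness[where i = "\<lambda>m. int m - int N" and j = "\<lambda>k. nat (k + int N)"])
       auto
  also have "\<dots> = (\<Sum>m\<le>2 * N. - (of_real c * ((-1) ^ N / v ^ N))
                  * (of_nat (2 * N choose m) * (- v) ^ m * 1 ^ (2 * N - m)))"
  proof (intro sum.cong refl)
    fix m
    have "(-1::real) powi (int m - int N - 1) = - ((-1) ^ m * (-1) ^ N)"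
      by (simp add: power_int_diff divide_simps)
    moreover have "(- v) ^ m = (-1) ^ m * v ^ m" by (rule power_minus)
    ultimately show "?a (int m - int N) = - (of_real c * ((-1) ^ N / v ^ N))
                  * (of_nat (2 * N choose m) * (- v) ^ m * 1 ^ (2 * N - m))"
      using assms by (simp add: power_int_diff)
  qed
  also have "\<dots> = - (of_real c * ((-1) ^ N / v ^ N)) * (- v + 1) ^ (2 * N)"
    unfolding sum_distrib_left[symmetric] by (subst binomial_ring) simp
  also have "\<dots> = - (of_real c * (- ((1 - v)\<^sup>2 / v)) ^ N)"
    by (simp add: power_minus[of "(1 - v)\<^sup>2 / v"] power_divide power_mult)
  finally show ?thesis by simp
qed

text \<open>The closed form at \<open>v = 1\<close> shows that the signed step weights sum to \<open>1\<close>.\<close>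
lemma M1_ge_1:
  assumes "N \<ge> 1"
  shows "M1 N c \<ge> 1"
proof -
  have "1 = cmod (step_gf N c 1)" using assms by (simp add: step_gf_closed_form power_0_left)
  also have "\<dots> \<le> (\<Sum>k\<in>{- int N..int N}. cmod (of_real (step_p N c k) * 1 powi k))"
    unfolding step_gf_def by (rule norm_sum)
  also have "\<dots> = M1 N c" by (simp add: M1_def)
  finally show ?thesis .
qed

section \<open>Optional stopping at the first overshooting time\<close>

abbreviation paths :: "nat \<Rightarrow> nat \<Rightarrow> (nat \<Rightarrow> int) set" where
  "paths N n \<equiv> {1..n} \<rightarrow>\<^sub>E {- int N..int N}"

definition path_weight :: "nat \<Rightarrow> real \<Rightarrow> nat \<Rightarrow> (nat \<Rightarrow> int) \<Rightarrow> real" where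
  "path_weight N c n u = (\<Prod>i\<in>{1..n}. step_p N c (u i))"

definition alive :: "nat \<Rightarrow> nat \<Rightarrow> nat \<Rightarrow> (nat \<Rightarrow> int) set" where
  "alive N b n = {u \<in> paths N n. \<forall>i\<in>{1..n}. walk u i < int b}"

definition alive_gf :: "nat \<Rightarrow> real \<Rightarrow> nat \<Rightarrow> nat \<Rightarrow> complex \<Rightarrow> complex" where
  "alive_gf N c b n v = (\<Sum>u\<in>alive N b n. of_real (path_weight N c n u) * v powi walk u n)"

lemma finite_paths: "finite (paths N n)"
  by (intro finite_PiE) auto

lemma finite_alive: "finite (alive N b n)"
  by (rule finite_subset[OF _ finite_paths[where N = N and n = n]]) (auto simp: alive_def)

lemma walk_upd:
  shows "i \<le> n \<Longrightarrow> walk (u(Suc n := k)) i = walk u i"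
    and "walk (u(Suc n := k)) (Suc n) = walk u n + k"
  by (auto simp: walk_def intro!: sum.cong)

lemma path_weight_upd:
  "path_weight N c (Suc n) (u(Suc n := k)) = path_weight N c n u * step_p N c k"
  by (auto simp: path_weight_def intro!: prod.cong)

lemma walk_Suc: "walk u (Suc n) = walk u n + u (Suc n)"
  by (simp add: walk_def)

lemma alive_walk_less:
  assumes "u \<in> alive N b n" "b \<ge> 1"
  shows "walk u n < int b"
proof (cases "n = 0")
  case True
  then show ?thesis using assms(2) by (simp add: walk_def)
next
  case False
  then show ?thesis using assms(1) by (simp add: alive_def)
qed

lemma alive_gf_0: "alive_gf N c b 0 v = 1"
  by (simp add: alive_gf_def alive_def path_weight_def walk_def)

text \<open>
  One more step multiplies the generating function of the surviving paths by \<open>step_gf N c v\<close>; the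
  extended paths either survive again or overshoot at this very step, and then they land in
  \<open>{b..b + N - 1}\<close>.
\<close>
lemma alive_gf_step:
  assumes "b \<ge> 1" "v \<noteq> 0"
  shows "step_gf N c v * alive_gf N c b n v = alive_gf N c b (Suc n) v
           + (\<Sum>l = b..b + N - 1. of_real (overshoot_prob N c b (Suc n) l) * v ^ l)"
proof -
  define h where "h u = of_real (path_weight N c (Suc n) u) * v powi walk u (Suc n)" for u
  \<comment> \<open>Paths with \<open>n + 1\<close> steps whose last step is unrestricted, and those which overshoot by it.\<close>
  define E where "E = {u \<in> paths N (Suc n). \<forall>i\<in>{1..n}. walk u i < int b}"
  define H where "H = {u \<in> E. walk u (Suc n) \<ge> int b}"
  let ?ext = "\<lambda>(k, u). u(Suc n := k)"
  have finE: "finite E" unfolding E_def using finite_paths by simp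
  have interval: "{1..Suc n} = insert (Suc n) {1..n}" by auto
  have E_eq: "E = ?ext ` ({- int N..int N} \<times> alive N b n)"
  proof (intro equalityI subsetI)
    fix u assume u: "u \<in> E"
    then obtain k g where kg: "k \<in> {- int N..int N}" "g \<in> paths N n" "u = g(Suc n := k)"
      unfolding E_def interval PiE_insert_eq by auto
    then have "g \<in> alive N b n" using u by (auto simp: E_def alive_def walk_upd)
    with kg show "u \<in> ?ext ` ({- int N..int N} \<times> alive N b n)" by auto
  next
    fix u assume "u \<in> ?ext ` ({- int N..int N} \<times> alive N b n)"
    then show "u \<in> E"
      unfolding E_def interval PiE_insert_eq by (auto simp: alive_def walk_upd)
  qed
  have inj: "inj_on ?ext ({- int N..int N} \<times> alive N b n)"
    by (rule inj_on_subset[OF inj_combinator[where S = "{1..n}" and T = "\<lambda>_. {- int N..int N}"]])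
       (auto simp: alive_def)
  have "step_gf N c v * alive_gf N c b n v
      = (\<Sum>(k, u)\<in>{- int N..int N} \<times> alive N b n. h (u(Suc n := k)))"
    unfolding step_gf_def alive_gf_def sum_product sum.cartesian_product h_def
    using assms by (intro sum.cong refl) (auto simp: path_weight_upd walk_upd power_int_add)
  also have "\<dots> = sum h E"
    unfolding E_eq using inj by (subst sum.reindex) (auto intro!: sum.cong)
  also have "\<dots> = sum h (E - H) + sum h H"
    using finE by (intro sum.subset_diff) (auto simp: H_def)
  also have "E - H = alive N b (Suc n)"
    by (auto simp: E_def H_def alive_def atLeastAtMostSuc_conv)
  also have "sum h (alive N b (Suc n)) = alive_gf N c b (Suc n) v"
    by (simp add: h_def alive_gf_def)
  also have "sum h H = (\<Sum>l = b..b + N - 1. sum h {u \<in> H. nat (walk u (Suc n)) = l})"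
  proof (rule sum.group[symmetric])
    show "finite H" using finE by (simp add: H_def)
    show "(\<lambda>u. nat (walk u (Suc n))) ` H \<subseteq> {b..b + N - 1}"
    proof safe
      fix u assume u: "u \<in> H"
      have "walk u n < int b"
        using u assms(1) by (cases "n = 0") (auto simp: H_def E_def walk_def[of _ 0])
      moreover have "u (Suc n) \<le> int N"
        using u by (force simp: H_def E_def dest: PiE_mem[where x = "Suc n"])
      ultimately have "walk u (Suc n) < int b + int N" by (simp add: walk_Suc)
      moreover have "walk u (Suc n) \<ge> int b" using u by (simp add: H_def)
      ultimately show "nat (walk u (Suc n)) \<in> {b..b + N - 1}" by auto
    qed
  qed auto
  also have "\<dots> = (\<Sum>l = b..b + N - 1. of_real (overshoot_prob N c b (Suc n) l) * v ^ l)"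
  proof (intro sum.cong refl)
    fix l assume l: "l \<in> {b..b + N - 1}"
    have "overshoot_prob N c b (Suc n) l = sum (path_weight N c (Suc n)) {u \<in> H. walk u (Suc n) = int l}"
      unfolding overshoot_prob_def pseudo_prob_def path_weight_def using l
      by (subst overshoot_event_eq) (auto intro!: sum.cong simp: H_def E_def atLeastLessThanSuc_atLeastAtMost)
    moreover have "{u \<in> H. nat (walk u (Suc n)) = l} = {u \<in> H. walk u (Suc n) = int l}"
      using assms(1) by (auto simp: H_def)
    ultimately show "sum h {u \<in> H. nat (walk u (Suc n)) = l}
        = of_real (overshoot_prob N c b (Suc n) l) * v ^ l"
      by (auto simp: h_def sum_distrib_right intro!: sum.cong)
  qed
  finally show ?thesis .
qed

text \<open>
  Surviving paths stay below \<open>b\<close>, so \<open>v\<close> to the power of their position is at most \<open>\<bar>v\<bar>\<^sup>b\<close>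
  however negative the position is; their total absolute weight is at most \<open>M\<^sub>1\<^sup>n\<close>.
\<close>
lemma norm_alive_gf_le:
  assumes "b \<ge> 1" "cmod v \<ge> 1"
  shows "cmod (alive_gf N c b n v) \<le> M1 N c ^ n * cmod v ^ b"
proof -
  have "cmod (alive_gf N c b n v)
      \<le> (\<Sum>u\<in>alive N b n. cmod (of_real (path_weight N c n u) * v powi walk u n))"
    unfolding alive_gf_def by (rule norm_sum)
  also have "\<dots> \<le> (\<Sum>u\<in>alive N b n. \<bar>path_weight N c n u\<bar> * cmod v ^ b)"
  proof (intro sum_mono)
    fix u assume "u \<in> alive N b n"
    then have "cmod v powi walk u n \<le> cmod v powi int b"
      using alive_walk_less assms by (intro power_int_increasing) (auto intro: less_imp_le)
    then show "cmod (of_real (path_weight N c n u) * v powi walk u n)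
        \<le> \<bar>path_weight N c n u\<bar> * cmod v ^ b"
      by (simp add: norm_mult norm_power_int mult_left_mono)
  qed
  also have "\<dots> \<le> (\<Sum>u\<in>paths N n. \<bar>path_weight N c n u\<bar> * cmod v ^ b)"
    by (intro sum_mono2 finite_paths) (auto simp: alive_def)
  also have "\<dots> = (\<Sum>u\<in>paths N n. \<Prod>i\<in>{1..n}. \<bar>step_p N c (u i)\<bar>) * cmod v ^ b"
    by (simp add: path_weight_def abs_prod sum_distrib_right)
  also have "(\<Sum>u\<in>paths N n. \<Prod>i\<in>{1..n}. \<bar>step_p N c (u i)\<bar>) = M1 N c ^ n"
    by (subst prod_sum_PiE[symmetric]) (auto simp: M1_def)
  finally show ?thesis .
qed

text \<open>
  Since \<open>z * step_gf N c v = 1\<close>, the one-step identity telescopes: \<open>1 - z\<^sup>n * alive_gf N c b n v\<close> is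
  the part of the generating function that comes from overshooting times up to \<open>n\<close>.
\<close>
lemma overshoot_gf_eq_1:
  assumes "N \<ge> 1" "b \<ge> 1" "cmod v \<ge> 1" "cmod z < 1 / M1 N c" "z * step_gf N c v = 1"
  shows "overshoot_gf N c b z v = 1"
proof -
  define F where "F k = (\<Sum>l = b..b + N - 1. of_real (overshoot_prob N c b (Suc k) l) * v ^ l)" for k
  define G where "G k = z ^ Suc k * F k" for k
  have telescope: "1 - z ^ n * alive_gf N c b n v = sum G {..<n}" for n
  proof (induction n)
    case 0
    then show ?case by (simp add: alive_gf_0)
  next
    case (Suc n)
    have "v \<noteq> 0" using assms(3) by auto
    have "z ^ n * alive_gf N c b n v = z ^ n * (z * step_gf N c v) * alive_gf N c b n v"
      using assms(5) by simp
    also have "\<dots> = z ^ Suc n * (step_gf N c v * alive_gf N c b n v)" by simp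
    also have "\<dots> = z ^ Suc n * alive_gf N c b (Suc n) v + G n"
      unfolding alive_gf_step[OF assms(2) \<open>v \<noteq> 0\<close>] G_def F_def by (simp add: algebra_simps)
    finally show ?case
      unfolding sum.lessThan_Suc Suc.IH[symmetric] by (simp add: algebra_simps del: power_Suc)
  qed
  have M: "M1 N c \<ge> 1" using assms(1) by (rule M1_ge_1)
  have "(\<lambda>n. (cmod z * M1 N c) ^ n * cmod v ^ b) \<longlonglongrightarrow> 0"
    using M assms(4) by (intro tendsto_mult_left_zero LIMSEQ_power_zero) (simp add: field_simps abs_mult)
  moreover have "cmod (z ^ n * alive_gf N c b n v) \<le> (cmod z * M1 N c) ^ n * cmod v ^ b" for n
  proof -
    have "cmod (z ^ n * alive_gf N c b n v) \<le> cmod z ^ n * (M1 N c ^ n * cmod v ^ b)"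
      using norm_alive_gf_le[OF assms(2,3)] by (simp add: norm_mult norm_power mult_left_mono)
    then show ?thesis by (simp add: power_mult_distrib)
  qed
  ultimately have "(\<lambda>n. z ^ n * alive_gf N c b n v) \<longlonglongrightarrow> 0"
    by (rule Lim_null_comparison[OF always_eventually[OF allI], rotated])
  then have "(\<lambda>n. 1 - z ^ n * alive_gf N c b n v) \<longlonglongrightarrow> 1 - 0"
    by (intro tendsto_diff tendsto_const)
  then have "G sums 1" unfolding telescope sums_def by simp
  moreover have "G sums overshoot_gf N c b z v"
  proof -
    have "(\<lambda>k. of_real (overshoot_prob N c b (Suc k) l) * z ^ Suc k) sums
          (\<Sum>k. of_real (overshoot_prob N c b (Suc k) l) * z ^ Suc k)" for l
      by (rule summable_sums[OF summable_norm_cancel[OF summable_overshoot_gf[OF assms(4)]]])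
    then have "(\<lambda>k. \<Sum>l = b..b + N - 1. of_real (overshoot_prob N c b (Suc k) l) * z ^ Suc k * v ^ l)
        sums overshoot_gf N c b z v"
      unfolding overshoot_gf_def by (intro sums_sum sums_mult2)
    moreover have "G = (\<lambda>k. \<Sum>l = b..b + N - 1. of_real (overshoot_prob N c b (Suc k) l) * z ^ Suc k * v ^ l)"
      unfolding G_def F_def sum_distrib_left by (simp only: mult_ac)
    ultimately show ?thesis by simp
  qed
  ultimately show ?thesis by (rule sums_unique2[symmetric])
qed

section \<open>The interpolation nodes\<close>

context
  fixes N :: nat and c z :: real
  assumes N: "N \<ge> 1" and c: "c > 0" and z: "0 < z" "z < 1"
begin

lemma root_u_props:
  shows root_u_eq: "(root_u N c j z)\<^sup>2
          - 2 * (1 + root_theta N j * of_real (root_w N c z)) * root_u N c j z + 1 = 0"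
    and norm_root_u: "cmod (root_u N c j z) < 1"
  using theI'[OF root_u_ex1[OF N c z, of j]] unfolding root_u_def by blast+

lemma root_u_nonzero: "root_u N c j z \<noteq> 0"
  using root_u_eq[of j] by auto

lemma root_w_pos: "root_w N c z > 0"
  using N c z by (simp add: root_w_def)

lemma norm_root_v: "cmod (root_v N c j z) > 1"
  using norm_root_u[of j] root_u_nonzero[of j]
  by (simp add: root_v_def norm_divide field_simps)

text \<open>The quotient \<open>(1 - v)\<^sup>2 / v\<close> is invariant under \<open>v \<mapsto> 1 / v\<close>, so it can be read off at \<open>u\<^sub>j\<close>.\<close>
lemma root_v_quotient:
  "(1 - root_v N c j z)\<^sup>2 / root_v N c j z = 2 * root_theta N j * of_real (root_w N c z)"
proof -
  let ?u = "root_u N c j z"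
  have u: "?u \<noteq> 0" by (rule root_u_nonzero)
  have "(1 - root_v N c j z)\<^sup>2 / root_v N c j z = (?u\<^sup>2 - 2 * ?u + 1) / ?u"
    using u by (simp add: root_v_def field_simps power2_eq_square)
  also have "?u\<^sup>2 - 2 * ?u + 1 = 2 * root_theta N j * of_real (root_w N c z) * ?u"
    using root_u_eq[of j] by (simp add: algebra_simps)
  finally show ?thesis using u by simp
qed

lemma neg_root_theta_power: "(- root_theta N j) ^ N = -1"
proof -
  have "(- root_theta N j) ^ N = exp (of_nat N * (\<i> * complex_of_real ((2 * real j - 1) / real N * pi)))"
    unfolding root_theta_def minus_minus by (rule exp_of_nat_mult[symmetric])
  also have "of_nat N * (\<i> * complex_of_real ((2 * real j - 1) / real N * pi))
      = of_nat j * (2 * of_real pi * \<i>) - of_real pi * \<i>"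
    using N by (simp add: field_simps)
  also have "exp \<dots> = -1"
    by (simp add: exp_diff exp_of_nat_mult)
  finally show ?thesis .
qed

text \<open>
  The closed form depends on \<open>v\<close> only through \<open>(1 - v)\<^sup>2 / v\<close>, and each \<open>2 \<theta>\<^sub>j w\<close> is a value of
  this quotient for which the closed form equals \<open>1 / z\<close>.
\<close>
lemma step_gf_root_v: "complex_of_real z * step_gf N c (root_v N c j z) = 1"
proof -
  have "(2 * root_w N c z) ^ N = (1 - z) / (c * z)"
    using N c z by (simp add: root_w_def)
  then have "complex_of_real ((2 * root_w N c z) ^ N) = of_real ((1 - z) / (c * z))"
    by (rule arg_cong)
  then have w: "(2 * complex_of_real (root_w N c z)) ^ N = of_real ((1 - z) / (c * z))"
    by (simp only: of_real_mult of_real_numeral of_real_power)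
  have "(- ((1 - root_v N c j z)\<^sup>2 / root_v N c j z)) ^ N
      = (- root_theta N j * (2 * of_real (root_w N c z))) ^ N"
    by (simp add: root_v_quotient mult_ac)
  also have "\<dots> = - of_real ((1 - z) / (c * z))"
    unfolding power_mult_distrib[of "- root_theta N j"] w neg_root_theta_power by (rule mult_minus1)
  finally have power: "(- ((1 - root_v N c j z)\<^sup>2 / root_v N c j z)) ^ N = - of_real ((1 - z) / (c * z))" .
  have "root_v N c j z \<noteq> 0" using norm_root_v[of j] by auto
  note gf = step_gf_closed_form[OF this, of N c, unfolded power]
  have "step_gf N c (root_v N c j z) = of_real (1 + c * ((1 - z) / (c * z)))"
    unfolding gf by simp
  also have "1 + c * ((1 - z) / (c * z)) = 1 / z" using c z by (simp add: field_simps)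
  finally show ?thesis using z by simp
qed

lemma inj_on_root_theta: "inj_on (root_theta N) {1..N}"
proof
  fix j k assume jk: "j \<in> {1..N}" "k \<in> {1..N}" "root_theta N j = root_theta N k"
  then obtain n :: int where "\<i> * complex_of_real ((2 * real j - 1) / real N * pi)
      = \<i> * complex_of_real ((2 * real k - 1) / real N * pi) + of_int (2 * n) * pi * \<i>"
    unfolding root_theta_def by (auto simp: exp_eq)
  then have "(2 * real j - 1) / real N * pi = (2 * real k - 1) / real N * pi + real_of_int (2 * n) * pi"
    by (simp add: complex_eq_iff)
  then have "((2 * real j - 1) / real N) * pi = ((2 * real k - 1) / real N + real_of_int (2 * n)) * pi"
    by (simp only: distrib_right)
  then have "(2 * real j - 1) / real N = (2 * real k - 1) / real N + real_of_int (2 * n)"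
    by (simp only: mult_cancel_right pi_neq_zero simp_thms)
  then have "real j = real k + real_of_int n * real N" using N by (simp add: field_simps)
  then have "real_of_int (int j) = real_of_int (int k + n * int N)" by simp
  then have eq: "int j = int k + n * int N" by (simp only: of_int_eq_iff)
  \<comment> \<open>Indices between \<open>1\<close> and \<open>N\<close> that agree modulo \<open>N\<close> are equal.\<close>
  have "\<bar>n\<bar> * int N = \<bar>int j - int k\<bar>" using eq by (simp add: abs_mult)
  also have "\<dots> < 1 * int N" using jk by auto
  finally have "\<bar>n\<bar> < 1" using N by (simp only: mult_less_cancel_right)
  then show "j = k" using eq by simp
qed

lemma inj_on_root_v: "inj_on (\<lambda>j. root_v N c j z) {1..N}"
proof (rule inj_onI)
  fix j k assume jk: "j \<in> {1..N}" "k \<in> {1..N}" "root_v N c j z = root_v N c k z"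
  then have "2 * root_theta N j * of_real (root_w N c z) = 2 * root_theta N k * of_real (root_w N c z)"
    unfolding root_v_quotient[symmetric] by simp
  then have "root_theta N j = root_theta N k" using root_w_pos by simp
  then show "j = k" using inj_on_root_theta jk by (auto dest: inj_onD)
qed

end

section \<open>The double generating function\<close>

text \<open>The overshooting place lies in a window of \<open>N\<close> consecutive integers that starts at \<open>b\<close>.\<close>
lemma overshoot_gf_as_poly:
  assumes "N \<ge> 1"
  obtains p where "degree p < N" "\<And>\<zeta>. overshoot_gf N c b z \<zeta> = \<zeta> ^ b * poly p \<zeta>"
proof
  define a where "a l = (\<Sum>k. complex_of_real (overshoot_prob N c b (Suc k) l) * z ^ Suc k)" for l
  define p where "p = (\<Sum>i<N. monom (a (b + i)) i)"
  have "degree p \<le> N - 1"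
    unfolding p_def by (intro degree_sum_le) (auto intro: order.trans[OF degree_monom_le])
  then show "degree p < N" using assms by simp
  fix \<zeta>
  have "overshoot_gf N c b z \<zeta> = (\<Sum>l = b..b + N - 1. a l * \<zeta> ^ l)"
    by (simp add: overshoot_gf_def a_def)
  also have "\<dots> = (\<Sum>i<N. a (b + i) * \<zeta> ^ (b + i))"
    using assms by (intro sum.reindex_bij_witness[where i = "\<lambda>i. b + i" and j = "\<lambda>l. l - b"]) auto
  also have "\<dots> = \<zeta> ^ b * poly p \<zeta>"
    by (simp add: p_def poly_sum poly_monom sum_distrib_left power_add mult_ac)
  finally show "overshoot_gf N c b z \<zeta> = \<zeta> ^ b * poly p \<zeta>" .
qed

theorem theorem5p4:
  fixes N b :: nat and c z :: real and \<zeta> :: complex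
  assumes "N \<ge> 1" and "b \<ge> 1" and "c > 0"
    and "0 < z" and "z < 1 / M1 N c"
  shows "overshoot_gf N c b (complex_of_real z) \<zeta> =
           (\<Sum>k = 1..N. lagrange_L N c k z \<zeta> * (root_u N c k z * \<zeta>) ^ b)
         \<and> (\<forall>k\<in>{1..N}. \<forall>j\<in>{1..N}.
              lagrange_L N c k z (root_v N c j z) = (if j = k then 1 else 0))"
proof
  have "1 / M1 N c \<le> 1" using M1_ge_1[OF assms(1), of c] by simp
  then have z: "z < 1" using assms(5) by linarith
  note setting = assms(1,3,4) z
  note inj = inj_on_root_v[OF setting]
  obtain p where p: "degree p < N"
    "\<And>\<zeta>. overshoot_gf N c b (complex_of_real z) \<zeta> = \<zeta> ^ b * poly p \<zeta>"
    using overshoot_gf_as_poly[OF assms(1)] by blast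
  \<comment> \<open>At a node the generating function is \<open>1\<close>, so the polynomial is the inverse of \<open>v\<^sub>k\<^sup>b\<close>.\<close>
  have node: "poly p (root_v N c k z) = root_u N c k z ^ b" for k
  proof -
    have "overshoot_gf N c b (complex_of_real z) (root_v N c k z) = 1"
      using norm_root_v[OF setting, of k] step_gf_root_v[OF setting, of k] assms
      by (intro overshoot_gf_eq_1) auto
    then show ?thesis
      unfolding p(2) using root_u_nonzero[OF setting, of k] by (simp add: root_v_def field_simps)
  qed
  have "poly p \<zeta> = (\<Sum>k = 1..N. root_u N c k z ^ b * lagrange_L N c k z \<zeta>)"
    using lagrange_interpolation[OF _ inj, of p \<zeta>] p(1) by (simp add: node lagrange_L_def)
  then show "overshoot_gf N c b (complex_of_real z) \<zeta> =
      (\<Sum>k = 1..N. lagrange_L N c k z \<zeta> * (root_u N c k z * \<zeta>) ^ b)"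
    unfolding p(2) by (simp add: sum_distrib_left power_mult_distrib mult_ac)
  show "\<forall>k\<in>{1..N}. \<forall>j\<in>{1..N}.
      lagrange_L N c k z (root_v N c j z) = (if j = k then 1 else 0)"
    unfolding lagrange_L_def using lagrange_basis_at_node[OF _ inj] by auto
qed

end
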